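(* Let $\mathbf{s}_1,\dots,\mathbf{s}_m\in\mathbb{R}^n$ and $t_1,\dots,t_m\in\mathbb{R}$ be such that the matrix $A\in\mathbb{R}^{m\times(n+2)}$ whose $i$-th row is $(-2t_i,\,2\mathbf{s}_i^T,\,-1)$ has rank $m\ge2$. Also assume that the system $$\lVert\mathbf{s}_i-\mathbf{x}\rVert^2=(t_i-b)^2\qquad(i=1,\dots,m)$$ has at least two solutions $(b,\mathbf{x})\in\mathbb{R}\times\mathbb{R}^n$. With $Q_{\mathrm{sol}}$ and $Q_{\mathrm{sat}}$ as defined in the context, we have: (a) If $\mathbf{s}_1,\dots,\mathbf{s}_m$ are not in general linear position, then (1) $Q_{\mathrm{sat}}$ is the affine subspace of dimension $m-2<n$ given by $Q_{\mathrm{sat}}=\langle\mathbf{s}_1,\dots,\mathbf{s}_m\rangle_{\mathrm{aff}}$. (2) $Q_{\mathrm{sol}}$ is a sphere inside an affine subspace $\mathcal{A}_{\mathrm{sol}}$ of dimension $k:=n-(m-2)$ that is perpendicular to $Q_{\mathrm{sat}}$. If $k=1$, $Q_{\mathrm{sol}}$ consists of two points. The center of the sphere $Q_{\mathrm{sol}}$ is the point where $\mathcal{A}_{\mathrm{sol}}$ and $Q_{\mathrm{sat}}$ meet. (b) If all $t_i$ are equal, then (1) $Q_{\mathrm{sat}}$ is a sphere inside the affine subspace $\mathcal{A}_{\mathrm{sat}}=\langle\mathbf{s}_1,\dots,\mathbf{s}_m\rangle_{\mathrm{aff}}$, which in this case has dimension $m-1$. If $m=2$, $Q_{\mathrm{sat}}$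 consists of the two points $\mathbf{s}_1$ and $\mathbf{s}_2$. (2) $Q_{\mathrm{sol}}$ is an affine subspace of dimension $n-(m-1)$ that is perpendicular to $\mathcal{A}_{\mathrm{sat}}$. The center of the sphere $Q_{\mathrm{sat}}$ is the point where $Q_{\mathrm{sol}}$ and $\mathcal{A}_{\mathrm{sat}}$ meet. Moreover, if neither the condition of (a) nor that of (b) is met, then $\mathbf{s}_1,\dots,\mathbf{s}_m$ are in general linear position with $m\le n+1$ and the $t_i$ are not all equal.
   Context: $n\ge1$; $\lVert\cdot\rVert$ is the Euclidean norm on $\mathbb{R}^n$; $\langle\cdot\rangle_{\mathrm{aff}}$ denotes the affine span. For $m\le n+1$, points $\mathbf{s}_1,\dots,\mathbf{s}_m$ are in general linear position if their affine span has dimension $m-1$ (under the hypotheses of the theorem $m\le n+1$ holds automatically). $\mathfrak{X}:=\{(b,\mathbf{x})\in\mathbb{R}\times\mathbb{R}^n\mid\lVert\mathbf{s}_i-\mathbf{x}\rVert^2=(t_i-b)^2\text{ for }i=1,\dots,m\}$; $\mathcal{S}:=\{(t,\mathbf{s})\in\mathbb{R}\times\mathbb{R}^n\mid\lVert\mathbf{s}-\mathbf{x}\rVert^2=(t-b)^2\text{ for all }(b,\mathbf{x})\in\mathfrak{X}\}$; $Q_{\mathrm{sol}}:=\{\mathbf{x}\mid(b,\mathbf{x})\in\mathfrak{X}\text{ for some }b\in\mathbb{R}\}$; $Q_{\mathrm{sat}}:=\{\mathbf{s}\mid(t,\mathbf{s})\in\mathcal{S}\text{ for some }t\in\mathbb{R}\}$.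 A sphere inside an affine subspace $\mathcal{A}$ is the set of all points of $\mathcal{A}$ at a fixed positive distance from a given point (the center) of $\mathcal{A}$. Two affine subspaces are called perpendicular here if their direction spaces are orthogonal. *)

theory Defs
  imports "HOL-Analysis.Analysis"
begin

text \<open>The index type \<open>'m\<close> stands for \<open>{1..m}\<close> with \<open>m = CARD('m)\<close>, and \<open>n = CARD('n)\<close>.\<close>

text \<open>The three blocks of \<open>unit + 'n + unit\<close> index the \<open>n + 2\<close> columns:
  row \<open>i\<close> is \<open>(- 2 t_i, 2 s_i, - 1)\<close>.\<close>

definition coeff_matrix :: "('m::finite \<Rightarrow> real ^ 'n) \<Rightarrow> ('m \<Rightarrow> real) \<Rightarrow> real ^ (unit + 'n + unit) ^ 'm"
  where "coeff_matrix s t =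
    (\<chi> i j. case j of Inl _ \<Rightarrow> - 2 * t i | Inr (Inl k) \<Rightarrow> 2 * s i $ k | Inr (Inr _) \<Rightarrow> - 1)"

definition solutions :: "('m \<Rightarrow> real ^ 'n) \<Rightarrow> ('m \<Rightarrow> real) \<Rightarrow> (real \<times> (real ^ 'n)) set"
  where "solutions s t = {(b, x). \<forall>i. (norm (s i - x))\<^sup>2 = (t i - b)\<^sup>2}"

definition satellites :: "('m \<Rightarrow> real ^ 'n) \<Rightarrow> ('m \<Rightarrow> real) \<Rightarrow> (real \<times> (real ^ 'n)) set"
  where "satellites s t =
    {(u, y). \<forall>(b, x) \<in> solutions s t. (norm (y - x))\<^sup>2 = (u - b)\<^sup>2}"

definition Q_sol :: "('m \<Rightarrow> real ^ 'n) \<Rightarrow> ('m \<Rightarrow> real) \<Rightarrow> (real ^ 'n) set"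
  where "Q_sol s t = {x. \<exists>b. (b, x) \<in> solutions s t}"

definition Q_sat :: "('m \<Rightarrow> real ^ 'n) \<Rightarrow> ('m \<Rightarrow> real) \<Rightarrow> (real ^ 'n) set"
  where "Q_sat s t = {y. \<exists>u. (u, y) \<in> satellites s t}"

definition general_linear_position :: "('m::finite \<Rightarrow> real ^ 'n) \<Rightarrow> bool"
  where "general_linear_position s \<longleftrightarrow> aff_dim (affine hull range s) = int CARD('m) - 1"

definition sphere_inside :: "'a::euclidean_space set \<Rightarrow> 'a \<Rightarrow> 'a set \<Rightarrow> bool"
  where "sphere_inside A c S \<longleftrightarrow>
    affine A \<and> c \<in> A \<and> (\<exists>r>0. S = {x \<in> A. dist c x = r})"

definition direction_space :: "'a::euclidean_space set \<Rightarrow> 'a set"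
  where "direction_space A = {x - y | x y. x \<in> A \<and> y \<in> A}"

text \<open>Orthogonality of the direction spaces only; the subspaces need not meet or be complementary.\<close>

definition perpendicular :: "'a::euclidean_space set \<Rightarrow> 'a set \<Rightarrow> bool"
  where "perpendicular A B \<longleftrightarrow>
    (\<forall>u \<in> direction_space A. \<forall>v \<in> direction_space B. orthogonal u v)"

end

theory Submission
  imports Defs
begin

text \<open>
  Full rank means that there is no affine relation among the points \<open>(t_i, s_i)\<close>. Let \<open>A\<close> be the
  affine span of the \<open>s_i\<close>, and let \<open>c\<close> be the foot in \<open>A\<close> of the perpendicular from one solution.

  If the \<open>s_i\<close> are not in general position, an affine relation among them cannot annihilate the
  \<open>t_i\<close>; summing the differences of the quadratic equations with its coefficients shows that \<open>b\<close> is
  the same for all solutions. The equations then say that \<open>x\<close> lies in the normal flat of \<open>A\<close> at \<open>c\<close>,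
  at a fixed distance from \<open>c\<close>. A point equidistant from antipodal pairs of this sphere
  lies in \<open>A\<close>.

  If all \<open>t_i\<close> equal \<open>\<tau>\<close>, then \<open>c\<close> has the same distance \<open>r\<close> from all \<open>s_i\<close>, and the solutions form the
  hyperboloid \<open>(\<tau> - b)\<^sup>2 = r\<^sup>2 + \<parallel>x - c\<parallel>\<^sup>2\<close> over the normal flat at \<open>c\<close>. Its symmetry \<open>b \<mapsto> 2 \<tau> - b\<close>
  forces \<open>u = \<tau>\<close> for every satellite.
\<close>

section \<open>Direction spaces and normal flats of affine subspaces\<close>

lemma direction_space_eq_translation:
  assumes "affine A" "a \<in> A"
  shows "direction_space A = (\<lambda>x. x - a) ` A"
proof
  show "direction_space A \<subseteq> (\<lambda>x. x - a) ` A"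
  proof
    fix v assume "v \<in> direction_space A"
    then obtain x y where "x \<in> A" "y \<in> A" and v: "v = x - y"
      unfolding direction_space_def by blast
    then have "a + 1 *\<^sub>R (x - y) \<in> A"
      using assms mem_affine_3_minus by blast
    then show "v \<in> (\<lambda>x. x - a) ` A"
      by (auto simp: v intro!: rev_image_eqI)
  qed
  show "(\<lambda>x. x - a) ` A \<subseteq> direction_space A"
    using assms unfolding direction_space_def by auto
qed

lemma subspace_direction_space:
  assumes "affine A" "A \<noteq> {}"
  shows "subspace (direction_space A)"
  using assms direction_space_eq_translation affine_diffs_subspace_subtract by fastforce

lemma add_direction_space_mem:
  assumes "affine A" "a \<in> A" "v \<in> direction_space A"
  shows "a + v \<in> A"
  using assms direction_space_eq_translation by fastforce

lemma aff_dim_eq_dim_direction_space: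
  assumes "affine A" "A \<noteq> {}"
  shows "aff_dim A = int (dim (direction_space A))"
proof -
  obtain a where a: "a \<in> A" using assms by blast
  have "aff_dim A = aff_dim ((\<lambda>x. x - a) ` A)"
    by (simp add: aff_dim_translation_eq_subtract)
  also have "\<dots> = aff_dim (direction_space A)"
    using direction_space_eq_translation[OF assms(1) a] by simp
  also have "\<dots> = int (dim (direction_space A))"
    using assms aff_dim_subspace subspace_direction_space by blast
  finally show ?thesis .
qed

text \<open>For nonempty \<open>A\<close> this is the affine subspace through \<open>c\<close> in
  the directions orthogonal to \<open>A\<close>. It serves as \<open>A_sol\<close> in case (a) and
  turns out to be \<open>Q_sol\<close> itself in case (b).\<close>

definition normal_flat :: "'a::euclidean_space set \<Rightarrow> 'a \<Rightarrow> 'a set"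
  where "normal_flat A c = {x. \<forall>v \<in> direction_space A. orthogonal v (x - c)}"

lemma foot_of_perpendicular:
  fixes A :: "'a::euclidean_space set"
  assumes "affine A" "A \<noteq> {}"
  obtains c where "c \<in> A" "x \<in> normal_flat A c"
proof -
  obtain a where a: "a \<in> A" using assms by blast
  have V: "subspace (direction_space A)" by (rule subspace_direction_space[OF assms])
  obtain y z where yz: "y \<in> span (direction_space A)"
      "\<And>w. w \<in> span (direction_space A) \<Longrightarrow> orthogonal z w" "x - a = y + z"
    using orthogonal_subspace_decomp_exists[of "direction_space A" "x - a"] by metis
  have "a + y \<in> A"
    using yz(1) V add_direction_space_mem[OF assms(1) a] by (metis span_eq_iff)
  moreover have "x - (a + y) = z" using yz(3) by (simp add: algebra_simps)
  then have "x \<in> normal_flat A (a + y)"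
    using yz(2) unfolding normal_flat_def by (simp add: orthogonal_commute span_base)
  ultimately show ?thesis using that by blast
qed

lemma normal_flat_inter:
  assumes "affine A" "c \<in> A"
  shows "normal_flat A c \<inter> A = {c}"
proof -
  have "x = c" if "x \<in> normal_flat A c" "x \<in> A" for x
  proof -
    have "x - c \<in> direction_space A" using that assms unfolding direction_space_def by blast
    then have "orthogonal (x - c) (x - c)" using that(1) unfolding normal_flat_def by blast
    then show ?thesis by (simp add: orthogonal_self)
  qed
  then show ?thesis using assms(2) by (auto simp: normal_flat_def orthogonal_def)
qed

lemma normal_flat_eq_translation:
  "normal_flat A c = (+) c ` {w. \<forall>v \<in> direction_space A. orthogonal v w}"
  by (force simp: normal_flat_def image_iff algebra_simps)

lemma affine_normal_flat: "affine (normal_flat A c)"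
  unfolding normal_flat_eq_translation
  by (simp add: affine_translation[symmetric] subspace_imp_affine subspace_orthogonal_to_vectors)

lemma aff_dim_normal_flat:
  fixes A :: "'a::euclidean_space set"
  assumes "affine A" "A \<noteq> {}"
  shows "aff_dim (normal_flat A c) = int DIM('a) - aff_dim A"
proof -
  let ?W = "{w. \<forall>v \<in> direction_space A. orthogonal v w}"
  have "dim ?W + dim (direction_space A) = DIM('a)"
    using dim_subspace_orthogonal_to_vectors[OF subspace_direction_space[OF assms] subspace_UNIV]
    by simp
  moreover have "aff_dim (normal_flat A c) = int (dim ?W)"
    unfolding normal_flat_eq_translation
    by (simp add: aff_dim_translation_eq aff_dim_subspace subspace_orthogonal_to_vectors)
  ultimately show ?thesis using aff_dim_eq_dim_direction_space[OF assms] by linarith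
qed

lemma perpendicular_normal_flat: "perpendicular (normal_flat A c) A"
proof -
  have "orthogonal (x - y) v"
    if "x \<in> normal_flat A c" "y \<in> normal_flat A c" "v \<in> direction_space A" for x y v
  proof -
    have "v \<bullet> (x - c) = 0" "v \<bullet> (y - c) = 0"
      using that unfolding normal_flat_def orthogonal_def by blast+
    then show ?thesis by (simp add: orthogonal_def inner_diff_right inner_commute[of _ v])
  qed
  then show ?thesis unfolding perpendicular_def by (auto simp: direction_space_def[of "normal_flat A c"])
qed

text \<open>The legs \<open>a - c\<close> and \<open>x - c\<close> are orthogonal. With
  \<open>a = s i\<close> this turns the equation at \<open>s i\<close> into a condition on the
  distance from \<open>x\<close> to \<open>c\<close>.\<close>

lemma pythagoras_normal_flat:
  assumes "x \<in> normal_flat A c" "a \<in> A" "c \<in> A"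
  shows "(norm (a - x))\<^sup>2 = (norm (a - c))\<^sup>2 + (norm (x - c))\<^sup>2"
proof -
  have "orthogonal (a - c) (x - c)"
    using assms unfolding normal_flat_def direction_space_def by blast
  then have "orthogonal (a - c) (c - x)" by (simp add: orthogonal_def inner_diff_right)
  from norm_add_Pythagorean[OF this] show ?thesis by (simp add: norm_minus_commute)
qed

text \<open>If \<open>x - c\<close> has the same inner product with every \<open>s i\<close>, then
  also with every point of their affine hull, because level sets of a linear functional are affine.
  The differences \<open>s i - s j\<close> are what the equations give access to.\<close>

lemma normal_flat_affine_hull_iff:
  fixes s :: "'m \<Rightarrow> 'a::euclidean_space"
  shows "x \<in> normal_flat (affine hull range s) c \<longleftrightarrow> (\<forall>i j. (s i - s j) \<bullet> (x - c) = 0)"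
proof
  assume "x \<in> normal_flat (affine hull range s) c"
  moreover have "s i - s j \<in> direction_space (affine hull range s)" for i j
    unfolding direction_space_def by (blast intro: hull_inc)
  ultimately show "\<forall>i j. (s i - s j) \<bullet> (x - c) = 0"
    unfolding normal_flat_def orthogonal_def by blast
next
  assume *: "\<forall>i j. (s i - s j) \<bullet> (x - c) = 0"
  have "(x - c) \<bullet> s i = (x - c) \<bullet> s undefined" for i
    using *[rule_format, of i undefined]
    unfolding inner_diff_left[of "s i"] inner_commute[of "x - c"] by linarith
  then have "range s \<subseteq> {y. (x - c) \<bullet> y = (x - c) \<bullet> s undefined}"
    by blast
  then have "affine hull range s \<subseteq> {y. (x - c) \<bullet> y = (x - c) \<bullet> s undefined}"
    by (intro hull_minimal affine_hyperplane)
  then show "x \<in> normal_flat (affine hull range s) c"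
    unfolding normal_flat_def direction_space_def orthogonal_def
    by (auto simp: inner_diff_right[of "x - c"] inner_commute[of _ "x - c"] subset_iff)
qed

section \<open>Affine independence of families and spheres on a line\<close>

text \<open>Coefficients are indexed by \<open>I\<close> rather than by points, to match the rows of
  the matrix. A repeated point would itself be a nontrivial relation, so \<open>s\<close> is
  injective on \<open>I\<close> and the usual criterion for sets applies.\<close>

lemma aff_dim_image_of_independent_family:
  fixes s :: "'m \<Rightarrow> 'a::euclidean_space"
  assumes "finite I"
    and indep: "\<And>c. sum c I = 0 \<Longrightarrow> (\<Sum>i\<in>I. c i *\<^sub>R s i) = 0 \<Longrightarrow> \<forall>i\<in>I. c i = 0"
  shows "aff_dim (s ` I) = int (card I) - 1"
proof -
  have inj: "inj_on s I"
  proof (rule inj_onI, rule ccontr)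
    fix i j assume ij: "i \<in> I" "j \<in> I" "s i = s j" "i \<noteq> j"
    \<comment> \<open>The relation with coefficient 1 at \<open>i\<close> and -1 at
      \<open>j\<close>, which holds because \<open>s i = s j\<close>.\<close>
    define c where "c k = (if k = i then 1 else 0) - (if k = j then 1 else (0::real))" for k
    have "sum c I = 0" using ij assms(1) by (simp add: c_def sum_subtractf)
    moreover have "(\<Sum>k\<in>I. c k *\<^sub>R s k) = s i - s j"
      using ij assms(1) by (simp add: c_def sum_subtractf scaleR_diff_left if_distrib[of "\<lambda>a. a *\<^sub>R _"] cong: if_cong)
    ultimately have "c i = 0" using indep[of c] ij by simp
    then show False using ij by (simp add: c_def)
  qed
  have "\<not> affine_dependent (s ` I)"
  proof
    assume "affine_dependent (s ` I)"
    then obtain U where "sum U (s ` I) = 0" "\<exists>v\<in>s ` I. U v \<noteq> 0" "(\<Sum>v\<in>s ` I. U v *\<^sub>R v) = 0"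
      using affine_dependent_explicit_finite[of "s ` I"] assms(1) by auto
    with indep[of "U \<circ> s"] show False by (auto simp: sum.reindex[OF inj])
  qed
  then show ?thesis
    by (simp add: affine_independent_iff_card card_image[OF inj])
qed

text \<open>A single vector spans the direction space; rescaled to length \<open>r\<close> it gives
  \<open>d\<close>, and the sphere is the pair \<open>c + d\<close>, \<open>c - d\<close>. This
  settles both \<open>k = 1\<close> in (a) and \<open>m = 2\<close> in (b).\<close>

lemma sphere_inside_line_card:
  assumes "sphere_inside L c S" "aff_dim L = 1"
  shows "card S = 2"
proof -
  obtain r where L: "affine L" "c \<in> L" and r: "r > 0" and S: "S = {x \<in> L. dist c x = r}"
    using assms(1) unfolding sphere_inside_def by blast
  have V: "subspace (direction_space L)" using L subspace_direction_space by blast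
  have "dim (direction_space L) = 1"
    using aff_dim_eq_dim_direction_space[OF L(1)] L(2) assms(2) by force
  then obtain B where B: "B \<subseteq> direction_space L" "independent B" "direction_space L \<subseteq> span B" "card B = 1"
    using basis_exists[of "direction_space L"] by metis
  then obtain e where e: "B = {e}" by (auto simp: card_1_singleton_iff)
  then have "e \<noteq> 0" using B(2) dependent_zero by blast
  define d where "d = (r / norm e) *\<^sub>R e"
  have d: "norm d = r" "d \<noteq> 0" using \<open>e \<noteq> 0\<close> r by (auto simp: d_def)
  have "d \<in> direction_space L" using B(1) e V by (simp add: d_def subspace_scale)
  then have mem: "c + d \<in> L" "c - d \<in> L"
    using add_direction_space_mem[OF L, of d] add_direction_space_mem[OF L, of "- d"] subspace_neg[OF V] by auto
  have "S = {c + d, c - d}"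
  proof
    show "{c + d, c - d} \<subseteq> S" using mem d by (auto simp: S dist_norm)
    show "S \<subseteq> {c + d, c - d}"
    proof
      fix x assume "x \<in> S"
      then have x: "x \<in> L" "norm (x - c) = r" by (auto simp: S dist_norm norm_minus_commute)
      have "x - c \<in> span {e}" using x(1) L B(3) e unfolding direction_space_def by blast
      then obtain k where k: "x - c = k *\<^sub>R e" by (auto simp: span_singleton)
      then have "\<bar>k\<bar> = r / norm e" using x(2) \<open>e \<noteq> 0\<close> by (simp add: field_simps)
      then have "k = r / norm e \<or> k = - (r / norm e)" by linarith
      then have "x - c = d \<or> x - c = - d" using k by (auto simp: d_def)
      then show "x \<in> {c + d, c - d}" by (auto simp: algebra_simps)
    qed
  qed
  moreover have "(c + d) - (c - d) = 2 *\<^sub>R d" by (simp add: scaleR_2)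
  then have "c + d \<noteq> c - d" using d(2) by (metis cancel_comm_monoid_add_class.diff_cancel scaleR_eq_0_iff zero_neq_numeral)
  ultimately show ?thesis by simp
qed

section \<open>The rank hypothesis and differences of solutions\<close>

text \<open>The three sums are, up to the factors -2, 2 and -1, the products of \<open>c\<close>
  with the columns of the matrix. Full row rank makes the transpose injective, so \<open>c\<close>
  vanishes.\<close>

lemma full_rank_coeff_matrix:
  fixes s :: "'m::finite \<Rightarrow> real ^ 'n" and t :: "'m \<Rightarrow> real"
  assumes "rank (coeff_matrix s t) = CARD('m)"
    and "sum c UNIV = 0" "(\<Sum>i\<in>UNIV. c i * t i) = 0" "(\<Sum>i\<in>UNIV. c i *\<^sub>R s i) = 0"
  shows "c i = 0"
proof -
  let ?A = "coeff_matrix s t" and ?c = "\<chi> i. c i"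
  have "inj ((*v) (transpose ?A))"
    using assms(1) full_rank_injective[of "transpose ?A"] by (simp add: rank_transpose)
  moreover have "transpose ?A *v ?c = transpose ?A *v 0"
  proof -
    have "(\<Sum>i\<in>UNIV. c i * s i $ k) = 0" for k
      using arg_cong[OF assms(4), of "\<lambda>v. v $ k"] by simp
    then have s: "(\<Sum>i\<in>UNIV. s i $ k * c i) = 0" for k
      by (simp add: mult.commute)
    have t: "(\<Sum>i\<in>UNIV. t i * c i) = 0" using assms(3) by (simp add: mult.commute)
    have "(\<Sum>i\<in>UNIV. ?A $ i $ j * c i) = 0" for j
    proof (cases j)
      case Inl
      then show ?thesis
        using t by (simp add: coeff_matrix_def sum_negf mult.assoc flip: sum_distrib_left)
    next
      case (Inr k)
      then show ?thesis
        using assms(2) s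
        by (cases k) (simp_all add: coeff_matrix_def sum_negf mult.assoc flip: sum_distrib_left)
    qed
    then show ?thesis by (simp add: vec_eq_iff matrix_vector_mult_def transpose_def)
  qed
  ultimately have "?c = 0" by (rule injD)
  then show ?thesis by (simp add: vec_eq_iff)
qed

text \<open>Subtracting the two quadratic equations cancels the squares of \<open>s i\<close> and
  \<open>t i\<close>. The last bracket does not depend on \<open>i\<close>, so it disappears under
  coefficients of sum zero and when two indices are compared.\<close>

lemma solutions_inner_eq:
  assumes "(b, x) \<in> solutions s t" "(b', x') \<in> solutions s t"
  shows "2 * (s i \<bullet> (x - x')) = 2 * t i * (b - b') + ((norm x)\<^sup>2 - (norm x')\<^sup>2 - b\<^sup>2 + b'\<^sup>2)"
proof -
  have "(norm (s i - x))\<^sup>2 = (t i - b)\<^sup>2" "(norm (s i - x'))\<^sup>2 = (t i - b')\<^sup>2"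
    using assms unfolding solutions_def by auto
  then have "s i \<bullet> s i - 2 * (s i \<bullet> x) + x \<bullet> x = (t i)\<^sup>2 - 2 * t i * b + b\<^sup>2"
      "s i \<bullet> s i - 2 * (s i \<bullet> x') + x' \<bullet> x' = (t i)\<^sup>2 - 2 * t i * b' + b'\<^sup>2"
    unfolding power2_norm_eq_inner power2_diff
    by (simp_all add: inner_diff_left inner_diff_right inner_commute)
  then show ?thesis
    unfolding power2_norm_eq_inner inner_diff_right right_diff_distrib by linarith
qed

section \<open>Points not in general linear position\<close>

text \<open>Full rank makes the affine relation \<open>c\<close> unique up to scaling. Omitting an
  index \<open>j\<close> with \<open>c j\<close> nonzero therefore leaves an independent family, so
  exactly one dimension is lost.\<close>

lemma aff_dim_affine_hull_range:
  fixes s :: "'m::finite \<Rightarrow> real ^ 'n"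
  assumes rank: "rank (coeff_matrix s t) = CARD('m)"
    and s: "sum c UNIV = 0" "(\<Sum>i\<in>UNIV. c i *\<^sub>R s i) = 0" "(\<Sum>i\<in>UNIV. c i * t i) \<noteq> 0"
    and ngp: "\<not> general_linear_position s"
  shows "aff_dim (affine hull range s) = int CARD('m) - 2"
proof -
  obtain j where j: "c j \<noteq> 0" using s(3) by force
  have "aff_dim (s ` (UNIV - {j})) = int (card (UNIV - {j})) - 1"
  proof (rule aff_dim_image_of_independent_family)
    fix d assume d: "sum d (UNIV - {j}) = (0::real)" "(\<Sum>i\<in>UNIV - {j}. d i *\<^sub>R s i) = 0"
    define e where "e = d(j := 0)"
    have e: "sum e UNIV = 0" "(\<Sum>i\<in>UNIV. e i *\<^sub>R s i) = 0"
      using d by (simp_all add: e_def sum.remove[of UNIV j] cong: sum.cong_simp)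
    \<comment> \<open>Chosen so that \<open>e - k c\<close> annihilates \<open>t\<close> as well and
      hence vanishes by full rank. At \<open>j\<close>, where \<open>e\<close> is zero and
      \<open>c\<close> is not, this gives \<open>k = 0\<close>.\<close>
    define k where "k = (\<Sum>i\<in>UNIV. e i * t i) / (\<Sum>i\<in>UNIV. c i * t i)"
    have "e i - k * c i = 0" for i
    proof (rule full_rank_coeff_matrix[OF rank])
      show "(\<Sum>i\<in>UNIV. e i - k * c i) = 0"
        using e s by (simp add: sum_subtractf flip: sum_distrib_left)
      have "(\<Sum>i\<in>UNIV. (e i - k * c i) * t i) = (\<Sum>i\<in>UNIV. e i * t i) - k * (\<Sum>i\<in>UNIV. c i * t i)"
        by (simp add: left_diff_distrib sum_subtractf sum_distrib_left mult.assoc)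
      then show "(\<Sum>i\<in>UNIV. (e i - k * c i) * t i) = 0" using s(3) by (simp add: k_def)
      have "(\<Sum>i\<in>UNIV. (e i - k * c i) *\<^sub>R s i) = (\<Sum>i\<in>UNIV. e i *\<^sub>R s i) - k *\<^sub>R (\<Sum>i\<in>UNIV. c i *\<^sub>R s i)"
        by (simp add: scaleR_left_diff_distrib sum_subtractf scaleR_right.sum)
      then show "(\<Sum>i\<in>UNIV. (e i - k * c i) *\<^sub>R s i) = 0" using e s by simp
    qed
    note ek = this
    then have "k = 0" using ek[of j] j by (simp add: e_def)
    then have "e i = 0" for i using ek[of i] by simp
    then show "\<forall>i\<in>UNIV - {j}. d i = 0" by (metis DiffE e_def fun_upd_other singletonI)
  qed simp
  moreover have "aff_dim (s ` (UNIV - {j})) \<le> aff_dim (range s)"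
    by (simp add: aff_dim_subset image_mono)
  moreover have "aff_dim (range s) \<le> int CARD('m) - 1"
    using aff_dim_le_card[of "range s"] card_image_le[of UNIV s] by simp
  ultimately show ?thesis using ngp by (simp add: general_linear_position_def card_Diff_singleton)
qed

text \<open>Failure of independence yields a nontrivial relation among the \<open>s i\<close>; if it
  also annihilated \<open>t\<close>, full rank would make it trivial.\<close>

lemma degenerate_position_relation:
  fixes s :: "'m::finite \<Rightarrow> real ^ 'n"
  assumes rank: "rank (coeff_matrix s t) = CARD('m)" and "\<not> general_linear_position s"
  obtains c where "sum c UNIV = 0" "(\<Sum>i\<in>UNIV. c i *\<^sub>R s i) = 0" "(\<Sum>i\<in>UNIV. c i * t i) \<noteq> 0"
proof -
  have "aff_dim (s ` UNIV) \<noteq> int (card (UNIV :: 'm set)) - 1"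
    using assms(2) by (simp add: general_linear_position_def)
  then obtain c where "sum c UNIV = 0" "(\<Sum>i\<in>UNIV. c i *\<^sub>R s i) = 0" "\<not> (\<forall>i. c i = 0)"
    using aff_dim_image_of_independent_family[of UNIV s] by auto
  then show ?thesis using that full_rank_coeff_matrix[OF rank] by metis
qed


lemma degenerate_solutions:
  fixes s :: "'m::finite \<Rightarrow> real ^ 'n"
  assumes c: "sum c UNIV = 0" "(\<Sum>i\<in>UNIV. c i *\<^sub>R s i) = 0" "(\<Sum>i\<in>UNIV. c i * t i) \<noteq> 0"
    and two: "\<exists>p \<in> solutions s t. \<exists>q \<in> solutions s t. p \<noteq> q"
  obtains b x0 r where "x0 \<in> affine hull range s" "r > 0"
    "solutions s t = {b} \<times> {x \<in> normal_flat (affine hull range s) x0. dist x0 x = r}"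
proof -
  let ?A = "affine hull range s"
  obtain b x1 where 1: "(b, x1) \<in> solutions s t" using two by auto
  obtain x0 where x0: "x0 \<in> ?A" "x1 \<in> normal_flat ?A x0"
    using foot_of_perpendicular[of ?A x1] by auto
  have b: "b' = b" if "(b', x') \<in> solutions s t" for b' x'
  proof -
    \<comment> \<open>The part of the difference equation common to all indices; it drops out
      because \<open>sum c UNIV = 0\<close>.\<close>
    define K where "K = (norm x')\<^sup>2 - (norm x1)\<^sup>2 - b'\<^sup>2 + b\<^sup>2"
    have "0 = 2 * ((\<Sum>i\<in>UNIV. c i *\<^sub>R s i) \<bullet> (x' - x1))" using c(2) by simp
    also have "\<dots> = (\<Sum>i\<in>UNIV. c i * (2 * (s i \<bullet> (x' - x1))))"
      by (simp add: inner_sum_left sum_distrib_left mult.left_commute)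
    also have "\<dots> = (\<Sum>i\<in>UNIV. c i * (2 * t i * (b' - b) + K))"
      unfolding solutions_inner_eq[OF that 1] K_def ..
    also have "\<dots> = (\<Sum>i\<in>UNIV. 2 * (b' - b) * (c i * t i) + K * c i)"
      by (intro sum.cong) (simp_all add: algebra_simps)
    also have "\<dots> = 2 * (b' - b) * (\<Sum>i\<in>UNIV. c i * t i) + K * sum c UNIV"
      by (simp only: sum.distrib sum_distrib_left)
    finally show ?thesis using c(1,3) by simp
  qed
  have normal: "x' \<in> normal_flat ?A x0" if "(b', x') \<in> solutions s t" for b' x'
    unfolding normal_flat_affine_hull_iff
  proof (intro allI)
    fix i j
    have "s i \<bullet> (x' - x1) = s j \<bullet> (x' - x1)"
      using solutions_inner_eq[OF that 1, of i] solutions_inner_eq[OF that 1, of j]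
      unfolding b[OF that] by simp
    moreover have "(s i - s j) \<bullet> (x1 - x0) = 0" 
      using x0(2)[unfolded normal_flat_affine_hull_iff] by blast
    ultimately show "(s i - s j) \<bullet> (x' - x0) = 0" by (simp add: inner_diff_left inner_diff_right)
  qed
  \<comment> \<open>Comparing Pythagoras for \<open>x\<close> and for the known solution
    \<open>x1\<close> reduces the equation at every \<open>s i\<close> to the same
    condition.\<close>
  have iff: "(b, x) \<in> solutions s t \<longleftrightarrow> dist x0 x = dist x0 x1" if "x \<in> normal_flat ?A x0" for x
  proof -
    have "(norm (s i - x))\<^sup>2 = (t i - b)\<^sup>2 \<longleftrightarrow> dist x0 x = dist x0 x1" for i
    proof -
      have "(norm (s i - x1))\<^sup>2 = (t i - b)\<^sup>2" using 1 by (simp add: solutions_def)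
      moreover have "s i \<in> ?A" by (simp add: hull_inc)
      ultimately have "(norm (s i - x))\<^sup>2 = (t i - b)\<^sup>2 \<longleftrightarrow> (norm (x - x0))\<^sup>2 = (norm (x1 - x0))\<^sup>2"
        using pythagoras_normal_flat[OF that _ x0(1), of "s i"]
          pythagoras_normal_flat[OF x0(2) _ x0(1), of "s i"] by linarith
      also have "\<dots> \<longleftrightarrow> dist x0 x = dist x0 x1"
        by (simp add: dist_norm norm_minus_commute power2_eq_iff_nonneg)
      finally show ?thesis .
    qed
    then show ?thesis by (simp add: solutions_def)
  qed
  have eq: "solutions s t = {b} \<times> {x \<in> normal_flat ?A x0. dist x0 x = dist x0 x1}"
  proof -
    have "(b', x) \<in> solutions s t \<longleftrightarrow> b' = b \<and> x \<in> normal_flat ?A x0 \<and> dist x0 x = dist x0 x1" for b' x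
      using b normal iff by blast
    then show ?thesis by auto
  qed
  \<comment> \<open>With \<open>b\<close> fixed, radius zero would leave only one solution.\<close>
  have "dist x0 x1 \<noteq> 0"
  proof
    assume "dist x0 x1 = 0"
    then have "solutions s t \<subseteq> {(b, x0)}" unfolding eq by auto
    then show False using two by blast
  qed
  then show ?thesis using that[OF x0(1) _ eq] by simp
qed

text \<open>A point of \<open>A\<close> is equidistant from the whole sphere by Pythagoras, and
  \<open>u - b\<close> can be taken as that distance. Conversely, equal distances from one antipodal
  pair already force a satellite into \<open>A\<close>.\<close>

lemma Q_sat_of_sphere_solutions:
  assumes A: "affine A" "c \<in> A" and "r > 0"
    and sol: "solutions s t = {b} \<times> {x \<in> normal_flat A c. dist c x = r}"
  shows "Q_sat s t = A"
proof
  show "A \<subseteq> Q_sat s t"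
  proof
    fix y assume y: "y \<in> A"
    have "(norm (y - x))\<^sup>2 = (b + sqrt ((norm (y - c))\<^sup>2 + r\<^sup>2) - b)\<^sup>2"
      if "x \<in> normal_flat A c" "dist c x = r" for x
      using pythagoras_normal_flat[OF that(1) y A(2)] that(2)
      by (simp add: dist_norm norm_minus_commute)
    then have "(b + sqrt ((norm (y - c))\<^sup>2 + r\<^sup>2), y) \<in> satellites s t"
      unfolding satellites_def sol by blast
    then show "y \<in> Q_sat s t" unfolding Q_sat_def by blast
  qed
  show "Q_sat s t \<subseteq> A"
  proof
    fix y assume "y \<in> Q_sat s t"
    then obtain u where u: "\<And>x. x \<in> normal_flat A c \<Longrightarrow> dist c x = r \<Longrightarrow> (norm (y - x))\<^sup>2 = (u - b)\<^sup>2"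
      unfolding Q_sat_def satellites_def sol by blast
    obtain y0 where y0: "y0 \<in> A" "y \<in> normal_flat A y0"
      using foot_of_perpendicular[of A y] A by blast
    \<comment> \<open>The component of \<open>y\<close> normal to \<open>A\<close>, rescaled so that
      \<open>c + w\<close> and \<open>c - w\<close> lie on the sphere. Equidistance makes
      \<open>y - c\<close> orthogonal to \<open>w\<close>, while \<open>y0 - c\<close> is orthogonal
      to it anyway.\<close>
    define w where "w = (r / norm (y - y0)) *\<^sub>R (y - y0)"
    have "y = y0"
    proof (rule ccontr)
      assume "y \<noteq> y0"
      then have w: "norm w = r" using \<open>r > 0\<close> by (simp add: w_def)
      have "c + w \<in> normal_flat A c" "c - w \<in> normal_flat A c"
        using y0(2) by (auto simp: normal_flat_def w_def orthogonal_def)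
      then have "(norm (y - (c + w)))\<^sup>2 = (norm (y - (c - w)))\<^sup>2"
        using u[of "c + w"] u[of "c - w"] w by (simp add: dist_norm)
      then have "(y - c) \<bullet> w = 0"
        unfolding power2_norm_eq_inner
        by (simp add: inner_diff_left inner_diff_right inner_add_left inner_add_right inner_commute)
      then have "(y - c) \<bullet> (y - y0) = 0"
        using \<open>y \<noteq> y0\<close> \<open>r > 0\<close> by (simp add: w_def)
      moreover have "(y0 - c) \<bullet> (y - y0) = 0"
        using y0 A(2) unfolding normal_flat_def direction_space_def orthogonal_def by blast
      ultimately have "(y - y0) \<bullet> (y - y0) = 0" by (simp add: inner_diff_left)
      then show False using \<open>y \<noteq> y0\<close> by simp
    qed
    then show "y \<in> A" using y0(1) by simp
  qed
qed

section \<open>Equal times\<close>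

text \<open>For constant times the term with \<open>b - b'\<close> is the same at every index, so
  differences of solutions are normal to the affine span although \<open>b\<close> varies. Radius
  zero is still allowed here.\<close>

lemma synchronous_solutions:
  fixes s :: "'m::finite \<Rightarrow> real ^ 'n"
  assumes "solutions s (\<lambda>_. \<tau>) \<noteq> {}"
  obtains x0 r where "x0 \<in> affine hull range s" "r \<ge> 0" "\<forall>i. dist x0 (s i) = r"
    "solutions s (\<lambda>_. \<tau>) = {(b, x). x \<in> normal_flat (affine hull range s) x0 \<and> (\<tau> - b)\<^sup>2 = r\<^sup>2 + (norm (x - x0))\<^sup>2}"
proof -
  let ?A = "affine hull range s"
  obtain b1 x1 where 1: "(b1, x1) \<in> solutions s (\<lambda>_. \<tau>)" using assms by auto
  obtain x0 where x0: "x0 \<in> ?A" "x1 \<in> normal_flat ?A x0"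
    using foot_of_perpendicular[of ?A x1] by auto
  \<comment> \<open>An arbitrary index serves as reference; the equations at \<open>x1\<close> show
    that the distance is the same for all of them.\<close>
  define r where "r = dist x0 (s undefined)"
  have s: "s i \<in> ?A" for i by (simp add: hull_inc)
  have "(norm (s i - x0))\<^sup>2 + (norm (x1 - x0))\<^sup>2 = (\<tau> - b1)\<^sup>2" for i
    using pythagoras_normal_flat[OF x0(2) s x0(1)] 1 by (simp add: solutions_def)
  from this this[of undefined] have "(norm (s i - x0))\<^sup>2 = (norm (s undefined - x0))\<^sup>2" for i
    by (metis add_right_cancel)
  then have r: "dist x0 (s i) = r" for i
    by (simp add: r_def dist_norm norm_minus_commute power2_eq_iff_nonneg)
  have normal: "x \<in> normal_flat ?A x0" if "(b, x) \<in> solutions s (\<lambda>_. \<tau>)" for b x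
    unfolding normal_flat_affine_hull_iff
  proof (intro allI)
    fix i j
    have "s i \<bullet> (x - x1) = s j \<bullet> (x - x1)"
      using solutions_inner_eq[OF that 1, of i] solutions_inner_eq[OF that 1, of j] by simp
    moreover have "(s i - s j) \<bullet> (x1 - x0) = 0" 
      using x0(2)[unfolded normal_flat_affine_hull_iff] by blast
    ultimately show "(s i - s j) \<bullet> (x - x0) = 0" by (simp add: inner_diff_left inner_diff_right)
  qed
  have d: "(norm (s i - x))\<^sup>2 = r\<^sup>2 + (norm (x - x0))\<^sup>2" if "x \<in> normal_flat ?A x0" for x i
    using pythagoras_normal_flat[OF that s x0(1)] r[of i] by (simp add: dist_norm norm_minus_commute)
  have "(b, x) \<in> solutions s (\<lambda>_. \<tau>) \<longleftrightarrow> (\<tau> - b)\<^sup>2 = r\<^sup>2 + (norm (x - x0))\<^sup>2"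
    if "x \<in> normal_flat ?A x0" for b x
    unfolding solutions_def using d[OF that] by auto
  then have "solutions s (\<lambda>_. \<tau>) = {(b, x). x \<in> normal_flat ?A x0 \<and> (\<tau> - b)\<^sup>2 = r\<^sup>2 + (norm (x - x0))\<^sup>2}"
    using normal by blast
  moreover have "r \<ge> 0" by (simp add: r_def)
  ultimately show ?thesis using that[OF x0(1)] r by blast
qed

lemma Q_sol_of_hyperboloid_solutions:
  assumes "solutions s t = {(b, x). x \<in> N \<and> (\<tau> - b)\<^sup>2 = r\<^sup>2 + (norm (x - c))\<^sup>2}"
  shows "Q_sol s t = N"
proof -
  have "\<exists>b. (\<tau> - b)\<^sup>2 = r\<^sup>2 + (norm (x - c))\<^sup>2" for x
    by (rule exI[of _ "\<tau> - sqrt (r\<^sup>2 + (norm (x - c))\<^sup>2)"]) simp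
  then show ?thesis by (auto simp: Q_sol_def assms)
qed

lemma Q_sat_of_hyperboloid_solutions:
  assumes A: "affine A" "c \<in> A" and "r > 0"
    and sol: "solutions s t = {(b, x). x \<in> normal_flat A c \<and> (\<tau> - b)\<^sup>2 = r\<^sup>2 + (norm (x - c))\<^sup>2}"
  shows "Q_sat s t = {y \<in> A. dist c y = r}"
proof
  show "{y \<in> A. dist c y = r} \<subseteq> Q_sat s t"
  proof
    fix y assume y: "y \<in> {y \<in> A. dist c y = r}"
    have "(norm (y - x))\<^sup>2 = r\<^sup>2 + (norm (x - c))\<^sup>2" if "x \<in> normal_flat A c" for x
      using pythagoras_normal_flat[OF that _ A(2), of y] y by (simp add: dist_norm norm_minus_commute)
    then have "(\<tau>, y) \<in> satellites s t" unfolding satellites_def sol by auto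
    then show "y \<in> Q_sat s t" unfolding Q_sat_def by blast
  qed
  show "Q_sat s t \<subseteq> {y \<in> A. dist c y = r}"
  proof
    fix y assume "y \<in> Q_sat s t"
    then obtain u where u: "\<And>b x. x \<in> normal_flat A c \<Longrightarrow> (\<tau> - b)\<^sup>2 = r\<^sup>2 + (norm (x - c))\<^sup>2
        \<Longrightarrow> (norm (y - x))\<^sup>2 = (u - b)\<^sup>2"
      unfolding Q_sat_def satellites_def sol by blast
    have c: "c \<in> normal_flat A c" by (simp add: normal_flat_def orthogonal_def)
    \<comment> \<open>The two vertices \<open>(\<tau> - r, c)\<close> and
      \<open>(\<tau> + r, c)\<close> of the hyperboloid lie symmetrically about
      \<open>\<tau>\<close>, which forces \<open>u = \<tau>\<close>.\<close>
    have yc: "(norm (y - c))\<^sup>2 = (u - (\<tau> - r))\<^sup>2" "(norm (y - c))\<^sup>2 = (u - (\<tau> + r))\<^sup>2"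
      using u[OF c, of "\<tau> - r"] u[OF c, of "\<tau> + r"] by simp_all
    moreover have "(u - (\<tau> - r))\<^sup>2 - (u - (\<tau> + r))\<^sup>2 = 4 * (r * (u - \<tau>))"
      by (simp add: power2_eq_square algebra_simps)
    ultimately have "r * (u - \<tau>) = 0" by linarith
    then have u_eq: "u = \<tau>" using \<open>r > 0\<close> by simp
    then have yr: "(norm (y - c))\<^sup>2 = r\<^sup>2" using yc by simp
    obtain y0 where y0: "y0 \<in> A" "y \<in> normal_flat A y0"
      using foot_of_perpendicular[of A y] A by blast
    \<comment> \<open>The normal component of \<open>y\<close>, moved to \<open>c\<close>. Then
      \<open>y - x = y0 - c\<close>, so its squared length is \<open>r\<^sup>2\<close> plus that of
      \<open>y - y0\<close>; Pythagoras for \<open>y\<close> gives \<open>r\<^sup>2\<close> minus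
      it, so \<open>y = y0\<close>.\<close>
    define x where "x = c + (y - y0)"
    have x: "x \<in> normal_flat A c" using y0(2) by (simp add: x_def normal_flat_def)
    have "(\<tau> - (\<tau> - sqrt (r\<^sup>2 + (norm (x - c))\<^sup>2)))\<^sup>2 = r\<^sup>2 + (norm (x - c))\<^sup>2" by simp
    from u[OF x this] have "(norm (y - x))\<^sup>2 = r\<^sup>2 + (norm (x - c))\<^sup>2" by (simp add: u_eq)
    moreover have "(norm (c - y))\<^sup>2 = (norm (c - y0))\<^sup>2 + (norm (y - y0))\<^sup>2"
      using pythagoras_normal_flat[OF y0(2) A(2) y0(1)] .
    ultimately have "(norm (y - y0))\<^sup>2 = 0"
      using yr by (simp add: x_def norm_minus_commute)
    then have "y = y0" by simp
    then show "y \<in> {y \<in> A. dist c y = r}"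
      using y0(1) yr \<open>r > 0\<close> by (simp add: dist_norm norm_minus_commute power2_eq_iff_nonneg)
  qed
qed

section \<open>Cases (a) and (b) and the remaining case\<close>

theorem theorem6p5:
  fixes s :: "'m::finite \<Rightarrow> real ^ 'n" and t :: "'m \<Rightarrow> real"
  assumes "rank (coeff_matrix s t) = CARD('m)"
    and "CARD('m) \<ge> 2"
    and "\<exists>p \<in> solutions s t. \<exists>q \<in> solutions s t. p \<noteq> q"
  shows
    "(\<not> general_linear_position s \<longrightarrow>
        (affine (Q_sat s t) \<and> aff_dim (Q_sat s t) = int CARD('m) - 2 \<and>
         int CARD('m) - 2 < int CARD('n) \<and>
         Q_sat s t = affine hull range s) \<and>
        (\<exists>A_sol c. sphere_inside A_sol c (Q_sol s t) \<and>
           aff_dim A_sol = int CARD('n) - (int CARD('m) - 2) \<and>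
           perpendicular A_sol (Q_sat s t) \<and>
           A_sol \<inter> Q_sat s t = {c}) \<and>
        (int CARD('n) - (int CARD('m) - 2) = 1 \<longrightarrow> card (Q_sol s t) = 2)) \<and>
     ((\<forall>i j. t i = t j) \<longrightarrow>
        aff_dim (affine hull range s) = int CARD('m) - 1 \<and>
        (\<exists>c. sphere_inside (affine hull range s) c (Q_sat s t) \<and>
           Q_sol s t \<inter> affine hull range s = {c}) \<and>
        (CARD('m) = 2 \<longrightarrow> Q_sat s t = range s \<and> card (Q_sat s t) = 2) \<and>
        affine (Q_sol s t) \<and>
        aff_dim (Q_sol s t) = int CARD('n) - (int CARD('m) - 1) \<and>
        perpendicular (Q_sol s t) (affine hull range s)) \<and>
     (\<not> (\<not> general_linear_position s) \<and> \<not> (\<forall>i j. t i = t j) \<longrightarrow>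
        general_linear_position s \<and> CARD('m) \<le> CARD('n) + 1 \<and> \<not> (\<forall>i j. t i = t j))"
proof -
  let ?A = "affine hull range s"
  have A: "affine ?A" "?A \<noteq> {}" by simp_all
  have degenerate: "(affine (Q_sat s t) \<and> aff_dim (Q_sat s t) = int CARD('m) - 2 \<and>
         int CARD('m) - 2 < int CARD('n) \<and> Q_sat s t = ?A) \<and>
        (\<exists>A_sol c. sphere_inside A_sol c (Q_sol s t) \<and>
           aff_dim A_sol = int CARD('n) - (int CARD('m) - 2) \<and>
           perpendicular A_sol (Q_sat s t) \<and> A_sol \<inter> Q_sat s t = {c}) \<and>
        (int CARD('n) - (int CARD('m) - 2) = 1 \<longrightarrow> card (Q_sol s t) = 2)"
    if ngp: "\<not> general_linear_position s"
  proof -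
    obtain k where k: "sum k UNIV = 0" "(\<Sum>i\<in>UNIV. k i *\<^sub>R s i) = 0" "(\<Sum>i\<in>UNIV. k i * t i) \<noteq> 0"
      by (rule degenerate_position_relation[OF assms(1) ngp])
    obtain b c r where c: "c \<in> ?A" and r: "r > 0"
      and sol: "solutions s t = {b} \<times> {x \<in> normal_flat ?A c. dist c x = r}"
      by (rule degenerate_solutions[OF k assms(3)])
    let ?N = "normal_flat ?A c"
    have dimA: "aff_dim ?A = int CARD('m) - 2"
      by (rule aff_dim_affine_hull_range[OF assms(1) k ngp])
    have sat: "Q_sat s t = ?A" by (rule Q_sat_of_sphere_solutions[OF A(1) c r sol])
    have dimN: "aff_dim ?N = int CARD('n) - (int CARD('m) - 2)"
      using aff_dim_normal_flat[OF A, of c] dimA by simp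
    have cN: "c \<in> ?N" by (simp add: normal_flat_def orthogonal_def)
    have "Q_sol s t = {x \<in> ?N. dist c x = r}" by (auto simp: Q_sol_def sol)
    then have sph: "sphere_inside ?N c (Q_sol s t)"
      using affine_normal_flat cN r unfolding sphere_inside_def by blast
    \<comment> \<open>A point of the sphere besides its center shows that the normal flat has
      positive dimension, which is the bound \<open>m - 2 < n\<close>.\<close>
    obtain x where x: "x \<in> ?N" "dist c x = r" using assms(3) sol by auto
    then have "x \<noteq> c" using r by auto
    then have "aff_dim ?N \<noteq> 0"
      using x(1) cN by (auto simp: aff_dim_eq_0)
    moreover have "aff_dim ?N \<ge> 0"
      using cN by (metis aff_dim_negative_iff empty_iff linorder_not_less)
    ultimately have "int CARD('m) - 2 < int CARD('n)" using dimN by linarith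
    moreover have "int CARD('n) - (int CARD('m) - 2) = 1 \<longrightarrow> card (Q_sol s t) = 2"
      using sphere_inside_line_card[OF sph] dimN by simp
    moreover have "perpendicular ?N (Q_sat s t)" "?N \<inter> Q_sat s t = {c}"
      unfolding sat by (rule perpendicular_normal_flat, rule normal_flat_inter[OF A(1) c])
    ultimately show ?thesis using A(1) dimA dimN sat sph by auto
  qed
  have synchronous: "aff_dim ?A = int CARD('m) - 1 \<and>
        (\<exists>c. sphere_inside ?A c (Q_sat s t) \<and> Q_sol s t \<inter> ?A = {c}) \<and>
        (CARD('m) = 2 \<longrightarrow> Q_sat s t = range s \<and> card (Q_sat s t) = 2) \<and>
        affine (Q_sol s t) \<and>
        aff_dim (Q_sol s t) = int CARD('n) - (int CARD('m) - 1) \<and>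
        perpendicular (Q_sol s t) ?A"
    if eq: "\<forall>i j. t i = t j"
  proof -
    define \<tau> where "\<tau> = t undefined"
    have t: "t = (\<lambda>_. \<tau>)" using eq by (auto simp: \<tau>_def)
    \<comment> \<open>Constant \<open>t\<close> is annihilated by any coefficients of sum zero, so
      the relation available in degenerate position cannot exist.\<close>
    have "general_linear_position s"
    proof (rule ccontr)
      assume "\<not> general_linear_position s"
      then obtain k where "sum k UNIV = 0" "(\<Sum>i\<in>UNIV. k i *\<^sub>R s i) = 0" "(\<Sum>i\<in>UNIV. k i * t i) \<noteq> 0"
        by (rule degenerate_position_relation[OF assms(1)])
      then show False by (simp add: t flip: sum_distrib_right)
    qed
    then have dimA: "aff_dim ?A = int CARD('m) - 1" by (simp add: general_linear_position_def)
    have "solutions s (\<lambda>_. \<tau>) \<noteq> {}" using assms(3) t by blast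
    then obtain c r where c: "c \<in> ?A" and r0: "r \<ge> 0" "\<forall>i. dist c (s i) = r"
      and "solutions s (\<lambda>_. \<tau>) = {(b, x). x \<in> normal_flat ?A c \<and> (\<tau> - b)\<^sup>2 = r\<^sup>2 + (norm (x - c))\<^sup>2}"
      by (rule synchronous_solutions)
    then have sol: "solutions s t = {(b, x). x \<in> normal_flat ?A c \<and> (\<tau> - b)\<^sup>2 = r\<^sup>2 + (norm (x - c))\<^sup>2}"
      unfolding t by blast
    \<comment> \<open>Radius zero would collapse all \<open>s i\<close> to \<open>c\<close>, but
      their span has dimension \<open>m - 1\<close>, at least 1.\<close>
    have "r \<noteq> 0"
    proof
      assume "r = 0"
      then have "range s = {c}" using r0(2) by auto
      then show False using dimA assms(2) by simp
    qed
    then have r: "r > 0" using r0 by simp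
    have Qsol: "Q_sol s t = normal_flat ?A c" by (rule Q_sol_of_hyperboloid_solutions[OF sol])
    have Qsat: "Q_sat s t = {y \<in> ?A. dist c y = r}"
      by (rule Q_sat_of_hyperboloid_solutions[OF A(1) c r sol])
    then have sph: "sphere_inside ?A c (Q_sat s t)"
      using A(1) c r unfolding sphere_inside_def by blast
    have "Q_sat s t = range s \<and> card (Q_sat s t) = 2" if m: "CARD('m) = 2"
    proof
      show card: "card (Q_sat s t) = 2" using sphere_inside_line_card[OF sph] dimA m by simp
      \<comment> \<open>A span of dimension 1 needs two distinct points \<open>s i\<close>, and
        these exhaust the two-point sphere.\<close>
      have "int (card (range s)) \<ge> 2" using aff_dim_le_card[of "range s"] dimA m by simp
      moreover have "range s \<subseteq> Q_sat s t" using r0(2) by (auto simp: Qsat hull_inc)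
      moreover have "finite (Q_sat s t)" using card by (intro card_ge_0_finite) simp
      ultimately show "Q_sat s t = range s" using card by (metis card_seteq of_nat_le_iff of_nat_numeral)
    qed
    then show ?thesis
      using dimA sph aff_dim_normal_flat[OF A, of c] affine_normal_flat perpendicular_normal_flat
        normal_flat_inter[OF A(1) c]
      unfolding Qsol by auto
  qed
  have "CARD('m) \<le> CARD('n) + 1" if "general_linear_position s"
    using that aff_dim_le_DIM[of "range s"] by (simp add: general_linear_position_def)
  then show ?thesis using degenerate synchronous by blast
qed

end
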